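(* Let $\Phi$ be a root system of type $B_\ell$ ($\ell\ge2$) and $\omega=\omega_1$. Then the set $\Phi_{\omega,0}^+=\{\beta\in\Phi^+:\beta^\omega=0\}$ is $$\Phi_{\omega,0}^+=\{e_1\}=\{\alpha_1+\cdots+\alpha_\ell\}.$$ Hence $P(0)=\{\pm1\}$.
   Context: Realize $\Phi$ of type $B_\ell$ in $E=\mathbb{R}^\ell$ with standard basis $e_1,\dots,e_\ell$ as $\{\pm e_p\}\cup\{\pm e_p\pm e_q:p<q\}$, with basis $\Delta$: $\alpha_i=e_i-e_{i+1}$ ($1\le i\le\ell-1$), $\alpha_\ell=e_\ell$; $\Phi^+$ is the corresponding set of positive roots. Let $\tilde\alpha=\sum_{i=1}^\ell n_i\alpha_i$ be the highest root, $\alpha_0=-\tilde\alpha$, $n_0=1$; then $J=\{i\in\{0,\dots,\ell\}:n_i=1\}=\{0,1\}$. Let $w_0$ be the longest element of the Weyl group $W$, $w_1$ the longest element of the subgroup generated by $s_{\alpha_2},\dots,s_{\alpha_\ell}$, and $\omega=\omega_1=w_1w_0$; it acts on $\{\alpha_0,\dots,\alpha_\ell\}$ by the index permutation $\sigma=(0\ 1)$. Put $x^\omega=\frac1{o(\omega)}\sum_{t=1}^{o(\omega)}\omega^t(x)$ with $o(\omega)=2$ the order of $\omega$. Let $\varpi_1^\vee,\dots,\varpi_\ell^\vee$ be the dual basis of $\Delta$, $\varpi_0^\vee=0$, and let $\pi_0^1=\varpi_0^\vee+\varpi_1^\vee$ be the sum over the $\langle\sigma\rangle$-orbit of $0$.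 Put $P(0)=\{(\gamma,\pi_0^1):\gamma\in\Phi,\ \gamma^\omega=0\}$. *)

theory Defs
  imports
    "HOL-Analysis.Analysis"
    "HOL-Algebra.Bij"
    "HOL-Algebra.Generated_Groups"
    "HOL-Algebra.Multiplicative_Group"
    "HOL-Combinatorics.Orbits"
begin

(* Below, Phi is a root system in a Euclidean space with basis alpha 1, ..., alpha l.
   The value alpha 0 is never used; the root alpha_0 is given by ext_simple. *)

definition positive_roots ::
  "'a::real_vector set \<Rightarrow> (nat \<Rightarrow> 'a) \<Rightarrow> nat \<Rightarrow> 'a set" where
  "positive_roots \<Phi> \<alpha> l =
     {\<beta> \<in> \<Phi>. \<exists>c :: nat \<Rightarrow> nat. \<beta> = (\<Sum>i = 1..l. real (c i) *\<^sub>R \<alpha> i)}"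

definition highest_root ::
  "'a::real_vector set \<Rightarrow> (nat \<Rightarrow> 'a) \<Rightarrow> nat \<Rightarrow> 'a" where
  "highest_root \<Phi> \<alpha> l =
     (THE \<beta>. \<beta> \<in> \<Phi> \<and>
        (\<forall>\<gamma>\<in>\<Phi>. \<exists>c :: nat \<Rightarrow> nat. \<beta> - \<gamma> = (\<Sum>i = 1..l. real (c i) *\<^sub>R \<alpha> i)))"

definition ext_simple ::
  "'a::real_vector set \<Rightarrow> (nat \<Rightarrow> 'a) \<Rightarrow> nat \<Rightarrow> nat \<Rightarrow> 'a" where
  "ext_simple \<Phi> \<alpha> l i = (if i = 0 then - highest_root \<Phi> \<alpha> l else \<alpha> i)"

definition reflection :: "'a::real_inner \<Rightarrow> 'a \<Rightarrow> 'a" where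
  "reflection \<gamma> x = x - (2 * (x \<bullet> \<gamma>) / (\<gamma> \<bullet> \<gamma>)) *\<^sub>R \<gamma>"

definition weyl_group :: "'a::real_inner set \<Rightarrow> ('a \<Rightarrow> 'a) set" where
  "weyl_group \<Phi> = generate (BijGroup UNIV) (reflection ` \<Phi>)"

definition parabolic_subgroup ::
  "(nat \<Rightarrow> 'a::real_inner) \<Rightarrow> nat set \<Rightarrow> ('a \<Rightarrow> 'a) set" where
  "parabolic_subgroup \<alpha> I = generate (BijGroup UNIV) ((\<lambda>i. reflection (\<alpha> i)) ` I)"

definition weyl_length ::
  "(nat \<Rightarrow> 'a::real_inner) \<Rightarrow> nat \<Rightarrow> ('a \<Rightarrow> 'a) \<Rightarrow> nat" where
  "weyl_length \<alpha> l w =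
     (LEAST k. \<exists>is. length is = k \<and> set is \<subseteq> {1..l} \<and>
        w = foldr (\<lambda>i f. reflection (\<alpha> i) \<circ> f) is id)"

definition longest_element ::
  "(nat \<Rightarrow> 'a::real_inner) \<Rightarrow> nat \<Rightarrow> ('a \<Rightarrow> 'a) set \<Rightarrow> ('a \<Rightarrow> 'a)" where
  "longest_element \<alpha> l H = (THE w. is_arg_max (weyl_length \<alpha> l) (\<lambda>v. v \<in> H) w)"

(* omega_j = w_j w_0, where w_j is the longest element of the subgroup generated by the
   simple reflections other than s_j. *)
definition omega ::
  "'a::real_inner set \<Rightarrow> (nat \<Rightarrow> 'a) \<Rightarrow> nat \<Rightarrow> nat \<Rightarrow> 'a \<Rightarrow> 'a" where
  "omega \<Phi> \<alpha> l j =
     longest_element \<alpha> l (parabolic_subgroup \<alpha> ({1..l} - {j})) \<circ>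
     longest_element \<alpha> l (weyl_group \<Phi>)"

(* x^omega, with o(omega) the order of omega as a bijection of the ambient space. *)
definition average :: "('a \<Rightarrow> 'a) \<Rightarrow> 'a::real_vector \<Rightarrow> 'a" where
  "average w x =
     (let d = group.ord (BijGroup UNIV) w in (1 / real d) *\<^sub>R (\<Sum>t = 1..d. (w ^^ t) x))"

(* The permutation sigma of {0..l} with omega (alpha_i) = alpha_(sigma i). *)
definition index_perm ::
  "'a::real_vector set \<Rightarrow> (nat \<Rightarrow> 'a) \<Rightarrow> nat \<Rightarrow> ('a \<Rightarrow> 'a) \<Rightarrow> nat \<Rightarrow> nat" where
  "index_perm \<Phi> \<alpha> l w i =
     (if i \<le> l
      then THE j. j \<le> l \<and> w (ext_simple \<Phi> \<alpha> l i) = ext_simple \<Phi> \<alpha> l j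
      else i)"

(* The dual basis is realised in the Euclidean space itself through the inner product. *)
definition fund_coweight ::
  "(nat \<Rightarrow> 'a::real_inner) \<Rightarrow> nat \<Rightarrow> nat \<Rightarrow> 'a" where
  "fund_coweight \<alpha> l i =
     (if i = 0 then 0
      else THE v. \<forall>j\<in>{1..l}. \<alpha> j \<bullet> v = (if j = i then 1 else 0))"

definition orbit_coweight ::
  "'a::real_inner set \<Rightarrow> (nat \<Rightarrow> 'a) \<Rightarrow> nat \<Rightarrow> ('a \<Rightarrow> 'a) \<Rightarrow> nat \<Rightarrow> 'a" where
  "orbit_coweight \<Phi> \<alpha> l w i =
     (\<Sum>j \<in> orbit (index_perm \<Phi> \<alpha> l w) i. fund_coweight \<alpha> l j)"

(* Phi^+_(omega,0). *)
definition vanishing_positive_roots ::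
  "'a::real_inner set \<Rightarrow> (nat \<Rightarrow> 'a) \<Rightarrow> nat \<Rightarrow> ('a \<Rightarrow> 'a) \<Rightarrow> 'a set" where
  "vanishing_positive_roots \<Phi> \<alpha> l w =
     {\<beta> \<in> positive_roots \<Phi> \<alpha> l. average w \<beta> = 0}"

(* P(0): a set of real numbers, the pairing (gamma, pi) being the inner product. *)
definition P_zero ::
  "'a::real_inner set \<Rightarrow> (nat \<Rightarrow> 'a) \<Rightarrow> nat \<Rightarrow> ('a \<Rightarrow> 'a) \<Rightarrow> real set" where
  "P_zero \<Phi> \<alpha> l w =
     {\<gamma> \<bullet> orbit_coweight \<Phi> \<alpha> l w 0 | \<gamma>. \<gamma> \<in> \<Phi> \<and> average w \<gamma> = 0}"

definition roots_B :: "(nat \<Rightarrow> 'a::real_vector) \<Rightarrow> nat \<Rightarrow> 'a set" where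
  "roots_B e l =
     {s *\<^sub>R e p | s p. s \<in> {1, -1} \<and> p \<in> {1..l}} \<union>
     {s *\<^sub>R e p + t *\<^sub>R e q | s t p q.
        s \<in> {1, -1} \<and> t \<in> {1, -1} \<and> p \<in> {1..l} \<and> q \<in> {1..l} \<and> p < q}"

definition simple_B :: "(nat \<Rightarrow> 'a::real_vector) \<Rightarrow> nat \<Rightarrow> nat \<Rightarrow> 'a" where
  "simple_B e l i = (if i < l then e i - e (i + 1) else e i)"

end

theory Submission
  imports Defs
begin

text \<open>
  The point is that \<open>\<omega>\<close> is the reflection in \<open>e\<^sub>1\<close>. Its average over a group of order two is then
  the orthogonal projection \<open>x \<mapsto> x - (x \<bullet> e\<^sub>1) e\<^sub>1\<close>, whose kernel is the line through \<open>e\<^sub>1\<close>, and the only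
  roots on this line are \<open>e\<^sub>1\<close> and \<open>- e\<^sub>1\<close>. Moreover \<open>\<omega>\<close> swaps \<open>\<alpha>\<^sub>0 = - e\<^sub>1 - e\<^sub>2\<close> and
  \<open>\<alpha>\<^sub>1 = e\<^sub>1 - e\<^sub>2\<close>, so the orbit coweight is the first fundamental coweight, which is \<open>e\<^sub>1\<close> again,
  and \<open>P(0)\<close> consists of the two values of \<open>\<plusminus> e\<^sub>1 \<bullet> e\<^sub>1\<close>.

  To see that \<open>\<omega>\<close> is this reflection, the two longest elements have to be found: \<open>w\<^sub>0 = -1\<close>, while
  \<open>w\<^sub>1\<close> fixes \<open>e\<^sub>1\<close> and negates the other basis vectors. The criterion is
  \<open>longest_element_eqI\<close>: an element of a group \<open>H\<close> of symmetries is its unique longest element as soon as its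
  inversions contain those of every element of \<open>H\<close>. It rests on two classical facts, proved
  here for every simple system whose only symmetry preserving positivity is the identity: the
  length is the number of inversions (\<open>weyl_length_eq_inversions\<close>), and the inversions determine
  the element (\<open>inversions_inj\<close>). For \<open>w\<^sub>0\<close> the criterion is immediate, as \<open>-1\<close> inverts
  every positive root. For \<open>w\<^sub>1\<close>, an element fixing \<open>e\<^sub>1\<close> preserves the first coordinate, which is
  nonnegative on positive roots; so it can only invert roots orthogonal to \<open>e\<^sub>1\<close>, and \<open>w\<^sub>1\<close>
  inverts all of these.

  The computations in type \<open>B\<close> are uniform because of two descriptions: the roots are the integral
  vectors of squared length 1 or 2 (\<open>root_iff\<close>), and the coefficient of \<open>\<alpha>\<^sub>k\<close> in a vector is the
  sum of its first \<open>k\<close> coordinates (\<open>simple_expansion\<close>), so that a root is positive iff these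
  partial sums are nonnegative (\<open>positive_iff\<close>).
\<close>

section \<open>Groups generated by involutive bijections\<close>

lemma BijGroup_UNIV_simps:
  "\<one>\<^bsub>BijGroup UNIV\<^esub> = id"
  "f \<in> carrier (BijGroup UNIV) \<longleftrightarrow> bij f"
  "bij f \<Longrightarrow> bij g \<Longrightarrow> f \<otimes>\<^bsub>BijGroup UNIV\<^esub> g = f \<circ> g"
  by (auto simp: BijGroup_def Bij_def extensional_def compose_def fun_eq_iff restrict_def)

lemma inv_BijGroup_involution:
  assumes "f \<circ> f = id"
  shows "inv\<^bsub>BijGroup UNIV\<^esub> f = f"
proof -
  interpret group "BijGroup UNIV" by (rule group_BijGroup)
  have "bij f" using assms by (metis o_bij)
  then show ?thesis using assms by (intro inv_equality) (auto simp: BijGroup_UNIV_simps)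
qed

lemma generate_BijGroup_bij:
  assumes "\<And>s. s \<in> S \<Longrightarrow> s \<circ> s = id" and "w \<in> generate (BijGroup UNIV) S"
  shows "bij w"
proof -
  interpret group "BijGroup UNIV" by (rule group_BijGroup)
  have "bij s" if "s \<in> S" for s using assms(1)[OF that] by (metis o_bij)
  then have "S \<subseteq> carrier (BijGroup UNIV)" by (auto simp: BijGroup_UNIV_simps)
  from generate_in_carrier[OF this assms(2)] show ?thesis by (simp add: BijGroup_UNIV_simps)
qed

lemma generate_BijGroup_comp:
  assumes "\<And>s. s \<in> S \<Longrightarrow> s \<circ> s = id"
    and "v \<in> generate (BijGroup UNIV) S" "w \<in> generate (BijGroup UNIV) S"
  shows "v \<circ> w \<in> generate (BijGroup UNIV) S"
  using generate.eng[OF assms(2,3)] generate_BijGroup_bij[OF assms(1)] assms(2,3)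
  by (simp add: BijGroup_UNIV_simps)

lemma generate_BijGroup_id: "id \<in> generate (BijGroup UNIV) S"
  using generate.one[of "BijGroup UNIV"] by (simp add: BijGroup_UNIV_simps)

text \<open>Since the generators are involutions, a property of the whole group needs no inverse case.\<close>

lemma generate_BijGroup_induct [consumes 1, case_names involution id gen comp]:
  assumes "w \<in> generate (BijGroup UNIV) S"
    and inv: "\<And>s. s \<in> S \<Longrightarrow> s \<circ> s = id"
    and "P id" and "\<And>s. s \<in> S \<Longrightarrow> P s" and comp: "\<And>v w. P v \<Longrightarrow> P w \<Longrightarrow> P (v \<circ> w)"
  shows "P w"
  using assms(1)
proof induction
  case one
  show ?case using assms(3) by (simp only: BijGroup_UNIV_simps)
next
  case (inv h)
  then show ?case using assms by (simp add: inv_BijGroup_involution)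
next
  case (eng v w)
  have "bij v" "bij w"
    using generate_BijGroup_bij[of S, OF inv] eng.hyps by auto
  with comp[OF eng.IH] show ?case by (simp only: BijGroup_UNIV_simps)
qed (use assms(4) in auto)

lemma ord_BijGroup_involution:
  assumes "f \<circ> f = id" "f \<noteq> id"
  shows "group.ord (BijGroup UNIV) f = 2"
proof -
  interpret group "BijGroup UNIV" by (rule group_BijGroup)
  have bij: "bij f" using assms by (metis o_bij)
  then have f: "f \<in> carrier (BijGroup UNIV)" by (simp add: BijGroup_UNIV_simps)
  have "f [^]\<^bsub>BijGroup UNIV\<^esub> (2::nat) = \<one>\<^bsub>BijGroup UNIV\<^esub>"
    using f bij assms(1) by (simp add: numeral_2_eq_2 BijGroup_UNIV_simps)
  then have "ord f dvd 2" using f by (simp add: pow_eq_id)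
  moreover have "ord f \<noteq> 1" using ord_eq_1[OF f] assms(2) by (simp add: BijGroup_UNIV_simps)
  ultimately show ?thesis using two_is_prime_nat prime_nat_iff by blast
qed

section \<open>Reflections\<close>

lemma reflection_involution: "reflection \<gamma> \<circ> reflection \<gamma> = id"
proof
  fix x
  show "(reflection \<gamma> \<circ> reflection \<gamma>) x = id x"
    by (cases "\<gamma> = 0")
       (simp_all add: reflection_def inner_diff_left algebra_simps flip: scaleR_left_distrib scaleR_left_diff_distrib)
qed

lemma reflection_reflection [simp]: "reflection \<gamma> (reflection \<gamma> x) = x"
  using reflection_involution[of \<gamma>] by (simp add: fun_eq_iff)

lemma reflection_self: "reflection \<gamma> \<gamma> = - \<gamma>"
  by (cases "\<gamma> = 0") (simp_all add: reflection_def scaleR_2)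

lemma orthogonal_transformation_reflection: "orthogonal_transformation (reflection \<gamma>)"
  unfolding orthogonal_transformation_def
proof (intro conjI allI)
  show "linear (reflection \<gamma>)"
    by (rule linearI) (simp_all add: reflection_def algebra_simps inner_add_left add_divide_distrib)
  show "reflection \<gamma> v \<bullet> reflection \<gamma> w = v \<bullet> w" for v w
    by (cases "\<gamma> = 0")
       (simp_all add: reflection_def inner_diff_left inner_diff_right inner_commute field_simps)
qed

lemma reflection_minus: "reflection \<gamma> (- x) = - reflection \<gamma> x"
  by (simp add: reflection_def)

text \<open>Used to produce reflections in non-simple roots as words in the simple ones.\<close>

lemma reflection_conjugate:
  assumes "orthogonal_transformation w"
  shows "reflection (w \<gamma>) \<circ> w = w \<circ> reflection \<gamma>"
  using assms
  by (auto simp: fun_eq_iff reflection_def orthogonal_transformation_def linear_diff linear_cmul)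

section \<open>Length and inversions in a simple system\<close>

text \<open>The Weyl group lies in this group. Working with it instead of the Weyl group
  makes membership a property to check rather than a derivation by generators.\<close>

definition root_symmetries :: "'a::real_inner set \<Rightarrow> ('a \<Rightarrow> 'a) set" where
  "root_symmetries \<Phi> = {w. orthogonal_transformation w \<and> w ` \<Phi> \<subseteq> \<Phi>}"

lemma root_symmetries_id: "id \<in> root_symmetries \<Phi>"
  by (auto simp: root_symmetries_def id_def)

lemma root_symmetries_comp:
  "v \<in> root_symmetries \<Phi> \<Longrightarrow> w \<in> root_symmetries \<Phi> \<Longrightarrow> v \<circ> w \<in> root_symmetries \<Phi>"
  by (auto simp: root_symmetries_def orthogonal_transformation_compose)

lemma root_symmetries_image:
  assumes "finite \<Phi>" "w \<in> root_symmetries \<Phi>"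
  shows "w ` \<Phi> = \<Phi>"
  using assms
  by (metis (lifting) endo_inj_surj inj_on_subset mem_Collect_eq orthogonal_transformation_inj
      root_symmetries_def subset_UNIV)

lemma root_symmetries_inv:
  fixes \<Phi> :: "'a::euclidean_space set"
  assumes "finite \<Phi>" "w \<in> root_symmetries \<Phi>"
  shows "inv_into UNIV w \<in> root_symmetries \<Phi>"
proof -
  have ort: "orthogonal_transformation w" using assms(2) by (simp add: root_symmetries_def)
  have "inv_into UNIV w ` \<Phi> = inv_into UNIV w ` w ` \<Phi>" using root_symmetries_image[OF assms] by simp
  also have "\<dots> = \<Phi>"
    using orthogonal_transformation_inj[OF ort] by (simp add: image_inv_f_f)
  finally show ?thesis
    using orthogonal_transformation_inv[OF ort] by (simp add: root_symmetries_def)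
qed

lemma root_symmetries_minus:
  "w \<in> root_symmetries \<Phi> \<Longrightarrow> w (- x) = - w x"
  by (simp add: root_symmetries_def orthogonal_transformation_linear linear_neg)

lemma reflection_root_symmetries:
  assumes "\<And>\<beta>. \<beta> \<in> \<Phi> \<Longrightarrow> reflection \<gamma> \<beta> \<in> \<Phi>"
  shows "reflection \<gamma> \<in> root_symmetries \<Phi>"
  using assms by (auto simp: root_symmetries_def orthogonal_transformation_reflection)

text \<open>The assumptions are the consequences of the root system axioms on which the theory of length is built.
  The vector \<open>h\<close> replaces linear independence of the simple roots: it separates positive from
  negative roots. The assumption \<open>rigid\<close> excludes isometric diagram automorphisms; it
  takes the place of the exchange condition, as an element without inversions is then the identity.\<close>

locale simple_system =
  fixes \<Phi> :: "'a::euclidean_space set" and \<alpha> :: "nat \<Rightarrow> 'a" and l :: nat and h :: 'a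
  assumes finite_roots: "finite \<Phi>"
    and zero_not_root: "0 \<notin> \<Phi>"
    and minus_root: "\<beta> \<in> \<Phi> \<Longrightarrow> - \<beta> \<in> \<Phi>"
    and reflection_root: "\<gamma> \<in> \<Phi> \<Longrightarrow> \<beta> \<in> \<Phi> \<Longrightarrow> reflection \<gamma> \<beta> \<in> \<Phi>"
    and simple_root: "i \<in> {1..l} \<Longrightarrow> \<alpha> i \<in> \<Phi>"
    and height_simple: "i \<in> {1..l} \<Longrightarrow> \<alpha> i \<bullet> h > 0"
    and positive_or_negative:
      "\<beta> \<in> \<Phi> \<Longrightarrow> \<beta> \<in> positive_roots \<Phi> \<alpha> l \<or> - \<beta> \<in> positive_roots \<Phi> \<alpha> l"
    and simple_reflection_positive:
      "i \<in> {1..l} \<Longrightarrow> \<beta> \<in> positive_roots \<Phi> \<alpha> l \<Longrightarrow> \<beta> \<noteq> \<alpha> i \<Longrightarrow>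
        reflection (\<alpha> i) \<beta> \<in> positive_roots \<Phi> \<alpha> l"
    and rigid:
      "w \<in> root_symmetries \<Phi> \<Longrightarrow> w ` positive_roots \<Phi> \<alpha> l \<subseteq> positive_roots \<Phi> \<alpha> l \<Longrightarrow> w = id"
begin

abbreviation "P \<equiv> positive_roots \<Phi> \<alpha> l"
abbreviation "G \<equiv> root_symmetries \<Phi>"
abbreviation "s i \<equiv> reflection (\<alpha> i)"

text \<open>These are the positive roots that the inverse of \<open>w\<close> makes negative. Compared with the positive roots
  made negative by \<open>w\<close> itself, this set behaves well when a simple reflection is composed on the left,
  which is how words are built up.\<close>

definition inversions :: "('a \<Rightarrow> 'a) \<Rightarrow> 'a set" where
  "inversions w = {\<beta> \<in> P. \<exists>\<gamma> \<in> P. \<beta> = - w \<gamma>}"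

lemma positive_imp_root: "\<beta> \<in> P \<Longrightarrow> \<beta> \<in> \<Phi>"
  by (simp add: positive_roots_def)

lemma finite_inversions: "finite (inversions w)"
  using finite_roots by (simp add: inversions_def positive_roots_def)

lemma simple_positive:
  assumes "i \<in> {1..l}"
  shows "\<alpha> i \<in> P"
proof -
  have "\<alpha> i = (\<Sum>j = 1..l. real (if j = i then 1 else 0) *\<^sub>R \<alpha> j)"
    using assms by (simp add: if_distrib[of real] if_distrib[of "\<lambda>c. c *\<^sub>R _"] cong: if_cong)
  then show ?thesis
    unfolding positive_roots_def using simple_root[OF assms] by (intro CollectI conjI exI)
qed

lemma height_positive:
  assumes "\<beta> \<in> P"
  shows "\<beta> \<bullet> h > 0"
proof -
  obtain c :: "nat \<Rightarrow> nat" where c: "\<beta> = (\<Sum>i = 1..l. real (c i) *\<^sub>R \<alpha> i)" and "\<beta> \<in> \<Phi>"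
    using assms by (auto simp: positive_roots_def)
  then have "\<beta> \<noteq> 0" using zero_not_root by auto
  then obtain i where i: "i \<in> {1..l}" "real (c i) *\<^sub>R \<alpha> i \<noteq> 0"
    using c by (metis (no_types, lifting) sum.neutral)
  have eq: "\<beta> \<bullet> h = (\<Sum>i = 1..l. real (c i) * (\<alpha> i \<bullet> h))" by (simp add: c inner_sum_left)
  show ?thesis
    unfolding eq
  proof (rule sum_pos2[of _ i])
    show "0 < real (c i) * (\<alpha> i \<bullet> h)" using i height_simple[of i] by simp
    show "0 \<le> real (c j) * (\<alpha> j \<bullet> h)" if "j \<in> {1..l}" for j
      using height_simple[OF that] by simp
  qed (use i in auto)
qed

lemma minus_not_positive: "\<beta> \<in> P \<Longrightarrow> - \<beta> \<notin> P"
  using height_positive[of \<beta>] height_positive[of "- \<beta>"] by auto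

lemma simple_reflection_symmetry: "i \<in> {1..l} \<Longrightarrow> s i \<in> G"
  using reflection_root simple_root by (intro reflection_root_symmetries) auto

lemma symmetry_root: "w \<in> G \<Longrightarrow> \<beta> \<in> \<Phi> \<Longrightarrow> w \<beta> \<in> \<Phi>"
  by (auto simp: root_symmetries_def)

lemma symmetry_inj: "w \<in> G \<Longrightarrow> inj w"
  by (simp add: root_symmetries_def orthogonal_transformation_inj)

text \<open>The simple reflection \<open>s i\<close> permutes the positive roots other than \<open>\<alpha> i\<close>, so composing with it moves
  the inversions by \<open>s i\<close> and only gains or loses \<open>\<alpha> i\<close>. This is the case of a loss; the case of a
  gain is the same statement read backwards, with \<open>s i \<circ> w\<close> in place of \<open>w\<close>.\<close>

lemma inversions_simple_reflection:
  assumes i: "i \<in> {1..l}" and w: "w \<in> G" and inv: "\<alpha> i \<in> inversions w"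
  shows "s i ` inversions (s i \<circ> w) = inversions w - {\<alpha> i}"
proof -
  obtain \<delta> where \<delta>: "\<delta> \<in> P" "\<alpha> i = - w \<delta>" using inv by (auto simp: inversions_def)
  have "s i \<beta> \<in> inversions w - {\<alpha> i}" if \<beta>: "\<beta> \<in> inversions (s i \<circ> w)" for \<beta>
  proof -
    obtain \<gamma> where \<gamma>: "\<beta> \<in> P" "\<gamma> \<in> P" "\<beta> = - s i (w \<gamma>)" using \<beta> by (auto simp: inversions_def)
    then have eq: "s i \<beta> = - w \<gamma>" by (simp add: reflection_minus)
    have "\<beta> \<noteq> \<alpha> i"
    proof
      assume "\<beta> = \<alpha> i"
      then have "w \<gamma> = \<alpha> i" using eq by (simp add: reflection_self)
      then have "w \<gamma> = w (- \<delta>)" using \<delta> w by (simp add: root_symmetries_minus)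
      then have "\<gamma> = - \<delta>" using symmetry_inj[OF w] by (simp add: inj_eq)
      then show False using minus_not_positive[OF \<delta>(1)] \<gamma>(2) by simp
    qed
    then have "s i \<beta> \<in> P" using simple_reflection_positive[OF i \<gamma>(1)] by simp
    moreover have "s i \<beta> \<noteq> \<alpha> i"
      using minus_not_positive[OF simple_positive[OF i]] \<gamma>(1) reflection_self
      by (metis reflection_reflection)
    ultimately show ?thesis using eq \<gamma> by (auto simp: inversions_def)
  qed
  moreover have "\<beta> \<in> s i ` inversions (s i \<circ> w)" if \<beta>: "\<beta> \<in> inversions w" "\<beta> \<noteq> \<alpha> i" for \<beta>
  proof (rule image_eqI)
    show "\<beta> = s i (s i \<beta>)" by simp
    obtain \<gamma> where \<gamma>: "\<beta> \<in> P" "\<gamma> \<in> P" "\<beta> = - w \<gamma>"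
      using \<beta>(1) by (auto simp: inversions_def)
    then show "s i \<beta> \<in> inversions (s i \<circ> w)"
      using simple_reflection_positive[OF i \<gamma>(1) \<beta>(2)]
      by (auto simp: inversions_def reflection_minus)
  qed
  ultimately show ?thesis by auto
qed

lemma card_inversions_down:
  assumes i: "i \<in> {1..l}" and w: "w \<in> G" and inv: "\<alpha> i \<in> inversions w"
  shows "card (inversions w) = Suc (card (inversions (s i \<circ> w)))"
proof -
  have "inj_on (s i) (inversions (s i \<circ> w))"
    using symmetry_inj[OF simple_reflection_symmetry[OF i]] inj_on_subset by blast
  then have "card (inversions (s i \<circ> w)) = card (inversions w - {\<alpha> i})"
    using inversions_simple_reflection[OF assms] card_image by metis
  then show ?thesis using card_Suc_Diff1[OF finite_inversions inv] by simp
qed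

lemma simple_inversion_cases:
  assumes i: "i \<in> {1..l}" and w: "w \<in> G" and inv: "\<alpha> i \<notin> inversions w"
  obtains \<gamma> where "\<gamma> \<in> P" "w \<gamma> = \<alpha> i"
proof -
  have "\<alpha> i \<in> w ` \<Phi>"
    using root_symmetries_image[OF finite_roots w] simple_root[OF i] by simp
  then obtain \<gamma> where \<gamma>: "\<gamma> \<in> \<Phi>" "w \<gamma> = \<alpha> i" by auto
  then have "- \<gamma> \<notin> P"
    using inv simple_positive[OF i] w
    by (auto simp: inversions_def root_symmetries_minus dest!: bspec[of _ _ "- \<gamma>"])
  then show ?thesis using positive_or_negative[OF \<gamma>(1)] \<gamma> that by auto
qed

lemma card_inversions_up:
  assumes i: "i \<in> {1..l}" and w: "w \<in> G" and inv: "\<alpha> i \<notin> inversions w"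
  shows "card (inversions (s i \<circ> w)) = Suc (card (inversions w))"
proof -
  obtain \<gamma> where "\<gamma> \<in> P" "w \<gamma> = \<alpha> i" using simple_inversion_cases[OF assms] .
  then have "\<alpha> i \<in> inversions (s i \<circ> w)"
    using simple_positive[OF i] by (auto simp: inversions_def reflection_self intro!: bexI[of _ \<gamma>])
  moreover have "s i \<circ> (s i \<circ> w) = w" by (simp add: fun_eq_iff)
  moreover have "s i \<circ> w \<in> G"
    using simple_reflection_symmetry[OF i] w by (rule root_symmetries_comp)
  ultimately show ?thesis using card_inversions_down[OF i, of "s i \<circ> w"] by metis
qed

text \<open>If no simple root is inverted, then each is the image of a positive root. An inversion \<open>\<beta> = - w \<gamma>\<close> is a
  nonnegative combination of simple roots, so \<open>- \<gamma>\<close> is the same combination of positive roots and has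
  nonnegative height, although \<open>\<gamma>\<close> is positive.\<close>

lemma simple_inversion_exists:
  assumes w: "w \<in> G" and ne: "inversions w \<noteq> {}"
  shows "\<exists>i\<in>{1..l}. \<alpha> i \<in> inversions w"
proof (rule ccontr)
  assume "\<not> ?thesis"
  then have "\<exists>\<gamma>. \<gamma> \<in> P \<and> w \<gamma> = \<alpha> i" if "i \<in> {1..l}" for i
    using simple_inversion_cases[OF that w] that by blast
  then obtain g where g: "\<And>i. i \<in> {1..l} \<Longrightarrow> g i \<in> P \<and> w (g i) = \<alpha> i" by metis
  obtain \<beta> \<gamma> where \<beta>: "\<beta> \<in> P" "\<gamma> \<in> P" "\<beta> = - w \<gamma>" using ne by (auto simp: inversions_def)
  obtain c :: "nat \<Rightarrow> nat" where c: "\<beta> = (\<Sum>i = 1..l. real (c i) *\<^sub>R \<alpha> i)"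
    using \<beta>(1) by (auto simp: positive_roots_def)
  have lin: "linear w" using w by (simp add: root_symmetries_def orthogonal_transformation_linear)
  have "w (- \<gamma>) = w (\<Sum>i = 1..l. real (c i) *\<^sub>R g i)"
    using c \<beta>(3) g root_symmetries_minus[OF w] by (simp add: linear_sum[OF lin] linear_cmul[OF lin])
  then have "- \<gamma> = (\<Sum>i = 1..l. real (c i) *\<^sub>R g i)" using symmetry_inj[OF w] by (simp add: inj_eq)
  then have "(- \<gamma>) \<bullet> h = (\<Sum>i = 1..l. real (c i) * (g i \<bullet> h))" by (simp add: inner_sum_left)
  moreover have "\<dots> \<ge> 0" using g height_positive by (intro sum_nonneg) (simp add: less_imp_le)
  ultimately show False using height_positive[OF \<beta>(2)] by simp
qed

lemma inversions_empty_imp_id: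
  assumes w: "w \<in> G" and e: "inversions w = {}"
  shows "w = id"
proof (rule rigid[OF w], rule image_subsetI)
  fix \<beta> assume "\<beta> \<in> P"
  then show "w \<beta> \<in> P"
    using e positive_or_negative[OF symmetry_root[OF w positive_imp_root[of \<beta>]]]
    by (auto simp: inversions_def)
qed

abbreviation word :: "nat list \<Rightarrow> 'a \<Rightarrow> 'a" where
  "word is \<equiv> foldr (\<lambda>i f. s i \<circ> f) is id"

lemma inversions_word_le:
  assumes "set is \<subseteq> {1..l}"
  shows "word is \<in> G \<and> card (inversions (word is)) \<le> length is"
  using assms
proof (induction "is")
  case Nil
  have "inversions id = {}" using minus_not_positive by (auto simp: inversions_def)
  then have "card (inversions id) = 0" by (simp only: card.empty)
  moreover have "word [] = id" by simp
  ultimately show ?case using root_symmetries_id[of \<Phi>] by (simp only: list.size le0 simp_thms)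
next
  case (Cons i "is")
  from Cons.prems have i: "i \<in> {1..l}" and "is": "set is \<subseteq> {1..l}" by auto
  from Cons.IH[OF "is"] have w: "word is \<in> G" and le: "card (inversions (word is)) \<le> length is"
    by blast+
  have "card (inversions (s i \<circ> word is)) \<le> Suc (card (inversions (word is)))"
    using card_inversions_down[OF i w] card_inversions_up[OF i w] by fastforce
  with le have "card (inversions (s i \<circ> word is)) \<le> length (i # is)" by simp
  moreover have "s i \<circ> word is \<in> G"
    using simple_reflection_symmetry[OF i] w by (rule root_symmetries_comp)
  moreover have "word (i # is) = s i \<circ> word is" by simp
  ultimately show ?case by (simp only: simp_thms)
qed

lemma reduced_word_exists:
  assumes "w \<in> G"
  shows "\<exists>is. length is = card (inversions w) \<and> set is \<subseteq> {1..l} \<and> w = word is"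
  using assms
proof (induction "card (inversions w)" arbitrary: w)
  case 0
  then have "w = id" using inversions_empty_imp_id finite_inversions by simp
  then show ?case using 0 by (intro exI[of _ "[]"]) simp
next
  case (Suc n)
  then have "inversions w \<noteq> {}" by auto
  then obtain i where i: "i \<in> {1..l}" "\<alpha> i \<in> inversions w"
    using simple_inversion_exists[OF Suc.prems] by blast
  have n: "n = card (inversions (s i \<circ> w))"
    using card_inversions_down[OF i(1) Suc.prems i(2)] Suc.hyps(2) by simp
  obtain "is" where "is": "length is = n" "set is \<subseteq> {1..l}" "s i \<circ> w = word is"
    using Suc.hyps(1)[OF n] root_symmetries_comp[OF simple_reflection_symmetry[OF i(1)] Suc.prems] n
    by auto
  have "w = s i \<circ> (s i \<circ> w)" by (simp add: fun_eq_iff)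
  then have "w = word (i # is)" using "is"(3) by simp
  then show ?case
    using "is" i(1) Suc.hyps(2) by (intro exI[of _ "i # is"]) simp
qed

text \<open>One letter changes the number of inversions by one, so a word is at least as long as that number; and while
  there are inversions, some simple root is one of them and its reflection removes it.\<close>

theorem weyl_length_eq_inversions:
  assumes "w \<in> G"
  shows "weyl_length \<alpha> l w = card (inversions w)"
  unfolding weyl_length_def
  by (rule Least_equality) (use reduced_word_exists[OF assms] inversions_word_le in blast)+

text \<open>The set of inversions tells, for each pair \<open>\<plusminus> \<beta>\<close>, which of the two lies in the image of the positive roots.
  So \<open>w\<close> and \<open>v\<close> send the positive roots to the same set, and \<open>v\<^sup>-\<^sup>1 w\<close> preserves them.\<close>

lemma inversions_inj:
  assumes w: "w \<in> G" and v: "v \<in> G" and eq: "inversions w = inversions v"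
  shows "w = v"
proof -
  have ortv: "orthogonal_transformation v" using v by (simp add: root_symmetries_def)
  have cancel: "v (inv_into UNIV v x) = x" for x
    using orthogonal_transformation_surj[OF ortv] by (simp add: surj_f_inv_f)
  define u where "u = inv_into UNIV v \<circ> w"
  have u: "u \<in> G"
    unfolding u_def using root_symmetries_inv[OF finite_roots v] w by (rule root_symmetries_comp)
  have vu: "v (u x) = w x" for x by (simp add: u_def cancel)
  have "u \<beta> \<in> P" if \<beta>: "\<beta> \<in> P" for \<beta>
  proof (rule ccontr)
    assume "u \<beta> \<notin> P"
    then have neg: "- u \<beta> \<in> P"
      using positive_or_negative[OF symmetry_root[OF u positive_imp_root[OF \<beta>]]] by simp
    have "w \<beta> \<in> P \<or> - w \<beta> \<in> P"
      using positive_or_negative[OF symmetry_root[OF w positive_imp_root[OF \<beta>]]] .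
    then show False
    proof
      assume "w \<beta> \<in> P"
      moreover have "w \<beta> = - v (- u \<beta>)" using vu root_symmetries_minus[OF v] by simp
      ultimately have "w \<beta> \<in> inversions w" using neg eq by (auto simp: inversions_def)
      then obtain \<gamma> where "\<gamma> \<in> P" "w \<beta> = w (- \<gamma>)"
        using root_symmetries_minus[OF w] by (auto simp: inversions_def)
      then show False
        using symmetry_inj[OF w] \<beta> minus_not_positive by (auto simp: inj_eq)
    next
      assume "- w \<beta> \<in> P"
      then have "- w \<beta> \<in> inversions w" using \<beta> by (auto simp: inversions_def)
      then have "- w \<beta> \<in> inversions v" using eq by simp
      then obtain \<gamma> where "\<gamma> \<in> P" "v (u \<beta>) = v \<gamma>" using vu by (auto simp: inversions_def)
      then show False
        using symmetry_inj[OF v] neg minus_not_positive by (auto simp: inj_eq)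
    qed
  qed
  then have "u = id" using rigid[OF u] by blast
  then show ?thesis using vu by (simp add: fun_eq_iff)
qed

theorem longest_element_eqI:
  assumes H: "H \<subseteq> G" and v: "v \<in> H" and max: "\<And>w. w \<in> H \<Longrightarrow> inversions w \<subseteq> inversions v"
  shows "longest_element \<alpha> l H = v"
  unfolding longest_element_def
proof (rule the_equality)
  have len: "weyl_length \<alpha> l w = card (inversions w)" if "w \<in> H" for w
    using weyl_length_eq_inversions H that by blast
  show "is_arg_max (weyl_length \<alpha> l) (\<lambda>v. v \<in> H) v"
    unfolding is_arg_max_def using v len card_mono[OF finite_inversions max] by fastforce
  fix w assume "is_arg_max (weyl_length \<alpha> l) (\<lambda>v. v \<in> H) w"
  then have w: "w \<in> H" and "weyl_length \<alpha> l v \<le> weyl_length \<alpha> l w"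
    using v by (auto simp: is_arg_max_def not_less)
  then have "card (inversions v) \<le> card (inversions w)" using len v by simp
  then have "inversions w = inversions v"
    using card_seteq[OF finite_inversions max[OF w]] by simp
  then show "w = v" using inversions_inj H w v by blast
qed

end


section \<open>Roots of type B in coordinates\<close>

lemma strict_mono_on_interval_id:
  fixes f :: "nat \<Rightarrow> nat"
  assumes "\<And>p. p \<in> {1..n} \<Longrightarrow> f p \<in> {1..n}" "\<And>p q. 1 \<le> p \<Longrightarrow> q \<le> n \<Longrightarrow> p < q \<Longrightarrow> f p < f q"
    and p: "p \<in> {1..n}"
  shows "f p = p"
proof (rule antisym)
  have "1 \<le> p" "p \<le> n" using p by auto
  then show "p \<le> f p"
  proof (induction p rule: dec_induct)
    case base
    then show ?case using assms(1)[of 1] by auto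
  next
    case (step m)
    then show ?case using assms(2)[of m "Suc m"] by auto
  qed
  show "f p \<le> p"
    using \<open>p \<le> n\<close> \<open>1 \<le> p\<close>
  proof (induction p rule: inc_induct)
    case base
    then show ?case using assms(1)[of n] by auto
  next
    case (step m)
    then show ?case using assms(2)[of m "Suc m"] by auto
  qed
qed

locale type_B =
  fixes e :: "nat \<Rightarrow> 'a::euclidean_space" and l :: nat
  assumes basis: "bij_betw e {1..l} Basis" and rank: "l \<ge> 2"
begin

abbreviation "\<Phi> \<equiv> roots_B e l"
abbreviation "\<alpha> \<equiv> simple_B e l"

text \<open>These are the fundamental coweights, by \<open>simple_coweight\<close>.\<close>

definition coweight :: "nat \<Rightarrow> 'a" where
  "coweight k = (\<Sum>p = 1..k. e p)"

lemma e_inner: "p \<in> {1..l} \<Longrightarrow> q \<in> {1..l} \<Longrightarrow> e p \<bullet> e q = (if p = q then 1 else 0)"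
  using basis bij_betwE[OF basis] by (auto simp: bij_betw_def inner_Basis inj_on_eq_iff)

lemma e_expansion: "x = (\<Sum>p = 1..l. (x \<bullet> e p) *\<^sub>R e p)"
proof -
  have "x = (\<Sum>b\<in>Basis. (x \<bullet> b) *\<^sub>R b)" by (simp add: euclidean_representation)
  also have "\<dots> = (\<Sum>p = 1..l. (x \<bullet> e p) *\<^sub>R e p)"
    using sum.reindex_bij_betw[OF basis, of "\<lambda>b. (x \<bullet> b) *\<^sub>R b"] by simp
  finally show ?thesis .
qed

lemma inner_self_e: "x \<bullet> x = (\<Sum>p = 1..l. (x \<bullet> e p)\<^sup>2)"
proof -
  have "x \<bullet> x = x \<bullet> (\<Sum>p = 1..l. (x \<bullet> e p) *\<^sub>R e p)" using e_expansion[of x] by simp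
  also have "\<dots> = (\<Sum>p = 1..l. (x \<bullet> e p)\<^sup>2)" by (simp add: inner_sum_right power2_eq_square)
  finally show ?thesis .
qed

lemma inner_e_integral:
  assumes "\<forall>p\<in>{1..l}. x \<bullet> e p \<in> \<int>" "\<forall>p\<in>{1..l}. y \<bullet> e p \<in> \<int>"
  shows "x \<bullet> y \<in> \<int>"
proof -
  have "x \<bullet> y = x \<bullet> (\<Sum>p = 1..l. (y \<bullet> e p) *\<^sub>R e p)" using e_expansion[of y] by simp
  also have "\<dots> = (\<Sum>p = 1..l. (y \<bullet> e p) * (x \<bullet> e p))" by (simp add: inner_sum_right)
  also have "\<dots> \<in> \<int>" using assms by (intro Ints_sum Ints_mult) auto
  finally show ?thesis .
qed

lemma e_coweight: "p \<in> {1..l} \<Longrightarrow> k \<le> l \<Longrightarrow> e p \<bullet> coweight k = (if p \<le> k then 1 else 0)"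
proof -
  assume p: "p \<in> {1..l}" and k: "k \<le> l"
  have "e p \<bullet> coweight k = (\<Sum>q = 1..k. if p = q then 1 else 0)"
    unfolding coweight_def inner_sum_right using p k by (intro sum.cong) (auto simp: e_inner)
  then show ?thesis using p by simp
qed

lemma simple_coweight:
  "i \<in> {1..l} \<Longrightarrow> k \<in> {1..l} \<Longrightarrow> \<alpha> i \<bullet> coweight k = (if i = k then 1 else 0)"
  by (auto simp: simple_B_def inner_diff_left e_coweight)

text \<open>Summation by parts: the telescoping leaves a boundary term with \<open>e (m + 1)\<close>, which the last simple root
  \<open>\<alpha> l = e l\<close> absorbs.\<close>

lemma simple_expansion: "x = (\<Sum>k = 1..l. (x \<bullet> coweight k) *\<^sub>R \<alpha> k)"
proof -
  \<comment> \<open>Only for \<open>m < l\<close>: the simple root of index \<open>l\<close> has a different shape.\<close>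
  have partial: "(\<Sum>k = 1..m. (x \<bullet> coweight k) *\<^sub>R \<alpha> k) =
      (\<Sum>p = 1..m. (x \<bullet> e p) *\<^sub>R e p) - (x \<bullet> coweight m) *\<^sub>R e (Suc m)" if "m < l" for m
    using that
    by (induction m) (simp_all add: coweight_def simple_B_def algebra_simps inner_add_right)
  obtain m where m: "l = Suc m" using rank by (cases l) auto
  have "(\<Sum>k = 1..l. (x \<bullet> coweight k) *\<^sub>R \<alpha> k) = (\<Sum>p = 1..l. (x \<bullet> e p) *\<^sub>R e p)"
    using partial[of m] m by (simp add: coweight_def simple_B_def algebra_simps inner_add_right)
  then show ?thesis using e_expansion[of x] by simp
qed

lemma sum_coweight:
  "k \<in> {1..l} \<Longrightarrow> (\<Sum>i = 1..l. c i *\<^sub>R \<alpha> i) \<bullet> coweight k = c k"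
proof -
  assume k: "k \<in> {1..l}"
  have "(\<Sum>i = 1..l. c i *\<^sub>R \<alpha> i) \<bullet> coweight k = (\<Sum>i = 1..l. if i = k then c i else 0)"
    unfolding inner_sum_left using k by (intro sum.cong) (auto simp: simple_coweight)
  then show ?thesis using k by simp
qed

lemma nat_combination_iff:
  "(\<exists>c :: nat \<Rightarrow> nat. x = (\<Sum>i = 1..l. real (c i) *\<^sub>R \<alpha> i)) \<longleftrightarrow>
    (\<forall>k\<in>{1..l}. x \<bullet> coweight k \<in> \<nat>)"
proof
  assume "\<forall>k\<in>{1..l}. x \<bullet> coweight k \<in> \<nat>"
  then have "\<forall>k\<in>{1..l}. \<exists>n. x \<bullet> coweight k = real n" by (auto elim!: Nats_cases)
  then obtain c where c: "\<forall>k\<in>{1..l}. x \<bullet> coweight k = real (c k)" by metis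
  have "x = (\<Sum>i = 1..l. (x \<bullet> coweight i) *\<^sub>R \<alpha> i)" by (rule simple_expansion)
  also have "\<dots> = (\<Sum>i = 1..l. real (c i) *\<^sub>R \<alpha> i)" using c by (intro sum.cong) auto
  finally have "x = (\<Sum>i = 1..l. real (c i) *\<^sub>R \<alpha> i)" .
  then show "\<exists>c :: nat \<Rightarrow> nat. x = (\<Sum>i = 1..l. real (c i) *\<^sub>R \<alpha> i)" by blast
next
  assume "\<exists>c :: nat \<Rightarrow> nat. x = (\<Sum>i = 1..l. real (c i) *\<^sub>R \<alpha> i)"
  then show "\<forall>k\<in>{1..l}. x \<bullet> coweight k \<in> \<nat>" by (metis sum_coweight of_nat_in_Nats)
qed

lemma root_cases [consumes 1, case_names short long]:
  assumes "x \<in> \<Phi>"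
  obtains a p where "a \<in> {1, -1}" "p \<in> {1..l}" "x = a *\<^sub>R e p"
  | a b p q where "a \<in> {1, -1}" "b \<in> {1, -1}" "p \<in> {1..l}" "q \<in> {1..l}" "p < q"
      "x = a *\<^sub>R e p + b *\<^sub>R e q"
  using assms unfolding roots_B_def by blast

lemma integral_coordinate_cases:
  assumes "\<forall>p\<in>{1..l}. x \<bullet> e p \<in> \<int>" "x \<bullet> x \<le> 2" "p \<in> {1..l}"
  shows "x \<bullet> e p \<in> {-1, 0, 1}"
proof -
  obtain m where m: "x \<bullet> e p = of_int m" using assms by (metis Ints_cases)
  have "(x \<bullet> e p)\<^sup>2 \<le> (\<Sum>p = 1..l. (x \<bullet> e p)\<^sup>2)"
    using assms(3) by (intro member_le_sum) auto
  then have "m\<^sup>2 \<le> 2" using assms(2) m inner_self_e[of x]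
    by (metis (mono_tags, lifting) of_int_le_iff of_int_numeral of_int_power order_trans)
  then have "\<bar>m\<bar> < 2" by (intro power2_less_imp_less[of "\<bar>m\<bar>"]) auto
  then show ?thesis using m by auto
qed

text \<open>This makes closure under reflections a matter of integrality, since reflections preserve length.
  In the converse direction the coordinates are at most one in absolute value, so the
  squared length counts the nonzero ones.\<close>

lemma root_iff:
  "x \<in> \<Phi> \<longleftrightarrow> (\<forall>p\<in>{1..l}. x \<bullet> e p \<in> \<int>) \<and> x \<bullet> x \<in> {1, 2}"
proof
  assume "x \<in> \<Phi>"
  then show "(\<forall>p\<in>{1..l}. x \<bullet> e p \<in> \<int>) \<and> x \<bullet> x \<in> {1, 2}"
    by (cases rule: root_cases) (auto simp: e_inner inner_add_left inner_add_right)
next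
  assume x: "(\<forall>p\<in>{1..l}. x \<bullet> e p \<in> \<int>) \<and> x \<bullet> x \<in> {1, 2}"
  have coord: "x \<bullet> e p \<in> {-1, 0, 1}" if "p \<in> {1..l}" for p
    using x that by (intro integral_coordinate_cases) auto
  \<comment> \<open>The support of \<open>x\<close>; its size is the squared length.\<close>
  define S where "S = {p \<in> {1..l}. x \<bullet> e p \<noteq> 0}"
  have S: "S \<subseteq> {1..l}" "\<And>p. p \<in> S \<Longrightarrow> x \<bullet> e p \<in> {1, -1}"
    using coord by (auto simp: S_def)
  have "x \<bullet> x = (\<Sum>p\<in>S. (x \<bullet> e p)\<^sup>2)"
    unfolding inner_self_e by (rule sum.mono_neutral_right) (auto simp: S_def)
  also have "\<dots> = (\<Sum>p\<in>S. 1)" using S(2) by (intro sum.cong) fastforce+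
  finally have card: "x \<bullet> x = real (card S)" by simp
  have sum: "x = (\<Sum>p\<in>S. (x \<bullet> e p) *\<^sub>R e p)"
    by (subst e_expansion[of x], rule sum.mono_neutral_right) (auto simp: S_def)
  from x card consider "card S = 1" | "card S = 2" by auto
  then show "x \<in> \<Phi>"
  proof cases
    case 1
    then obtain p where "S = {p}" by (auto simp: card_1_singleton_iff)
    then have "x = (x \<bullet> e p) *\<^sub>R e p" "p \<in> {1..l}" "x \<bullet> e p \<in> {1, -1}" using sum S by auto
    then show ?thesis unfolding roots_B_def by blast
  next
    case 2
    then obtain p q where pq: "S = {p, q}" "p < q"
      by (metis card_2_iff insert_commute linorder_neqE_nat)
    then have "x = (x \<bullet> e p) *\<^sub>R e p + (x \<bullet> e q) *\<^sub>R e q" using sum by simp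
    moreover have "p \<in> {1..l}" "q \<in> {1..l}" "x \<bullet> e p \<in> {1, -1}" "x \<bullet> e q \<in> {1, -1}"
      using pq S by auto
    ultimately show ?thesis using pq(2) unfolding roots_B_def by blast
  qed
qed

lemma root_coordinate: "x \<in> \<Phi> \<Longrightarrow> p \<in> {1..l} \<Longrightarrow> x \<bullet> e p \<in> {-1, 0, 1}"
  by (rule integral_coordinate_cases) (auto simp: root_iff)

lemma coweight_integral: "k \<le> l \<Longrightarrow> x \<in> \<Phi> \<Longrightarrow> x \<bullet> coweight k \<in> \<int>"
  unfolding coweight_def inner_sum_right using root_iff by (intro Ints_sum) auto

lemma positive_iff:
  "\<beta> \<in> positive_roots \<Phi> \<alpha> l \<longleftrightarrow> \<beta> \<in> \<Phi> \<and> (\<forall>k\<in>{1..l}. \<beta> \<bullet> coweight k \<ge> 0)"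
  unfolding positive_roots_def nat_combination_iff
  using coweight_integral by (auto simp: Nats_altdef2)

lemma e_positive: "p \<in> {1..l} \<Longrightarrow> e p \<in> positive_roots \<Phi> \<alpha> l"
  by (auto simp: positive_iff e_coweight root_iff e_inner)

lemma finite_roots_B: "finite \<Phi>"
proof -
  have "\<Phi> \<subseteq> (\<lambda>(a, p). a *\<^sub>R e p) ` ({1, -1} \<times> {1..l}) \<union>
      (\<lambda>(a, b, p, q). a *\<^sub>R e p + b *\<^sub>R e q) ` ({1, -1} \<times> {1, -1} \<times> {1..l} \<times> {1..l})"
  proof
    fix x assume "x \<in> \<Phi>"
    then show "x \<in> (\<lambda>(a, p). a *\<^sub>R e p) ` ({1, -1} \<times> {1..l}) \<union>
        (\<lambda>(a, b, p, q). a *\<^sub>R e p + b *\<^sub>R e q) ` ({1, -1} \<times> {1, -1} \<times> {1..l} \<times> {1..l})"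
    proof (cases rule: root_cases)
      case (short a p)
      then show ?thesis by (intro UnI1 image_eqI[of _ _ "(a, p)"]) auto
    next
      case (long a b p q)
      then show ?thesis by (intro UnI2 image_eqI[of _ _ "(a, b, p, q)"]) auto
    qed
  qed
  then show ?thesis by (rule finite_subset) auto
qed

lemma minus_root_B: "\<beta> \<in> \<Phi> \<Longrightarrow> - \<beta> \<in> \<Phi>"
  by (simp add: root_iff)

text \<open>The coefficient \<open>2 (\<beta> \<bullet> \<gamma>) / (\<gamma> \<bullet> \<gamma>)\<close> is an integer because \<open>\<gamma> \<bullet> \<gamma>\<close> divides two.\<close>

lemma reflection_root_B:
  assumes "\<gamma> \<in> \<Phi>" "\<beta> \<in> \<Phi>"
  shows "reflection \<gamma> \<beta> \<in> \<Phi>"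
proof -
  have \<gamma>: "\<forall>p\<in>{1..l}. \<gamma> \<bullet> e p \<in> \<int>" "\<gamma> \<bullet> \<gamma> \<in> {1, 2}"
    and \<beta>: "\<forall>p\<in>{1..l}. \<beta> \<bullet> e p \<in> \<int>" "\<beta> \<bullet> \<beta> \<in> {1, 2}" using assms by (auto simp: root_iff)
  have "\<beta> \<bullet> \<gamma> \<in> \<int>" using \<gamma> \<beta> by (intro inner_e_integral)
  then have "2 * (\<beta> \<bullet> \<gamma>) / (\<gamma> \<bullet> \<gamma>) \<in> \<int>" using \<gamma>(2) by auto
  then have "\<forall>p\<in>{1..l}. reflection \<gamma> \<beta> \<bullet> e p \<in> \<int>"
    using \<gamma> \<beta> by (auto simp: reflection_def inner_diff_left simp del: times_divide_eq_left)
  moreover have "reflection \<gamma> \<beta> \<bullet> reflection \<gamma> \<beta> = \<beta> \<bullet> \<beta>"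
    using orthogonal_transformation_reflection by (auto simp: orthogonal_transformation_def)
  ultimately show ?thesis using \<beta>(2) by (simp add: root_iff)
qed

lemma simple_root_B: "i \<in> {1..l} \<Longrightarrow> \<alpha> i \<in> \<Phi>"
  by (auto simp: root_iff simple_B_def inner_diff_left inner_diff_right e_inner)

lemma positive_or_negative_B:
  assumes "\<beta> \<in> \<Phi>"
  shows "\<beta> \<in> positive_roots \<Phi> \<alpha> l \<or> - \<beta> \<in> positive_roots \<Phi> \<alpha> l"
proof -
  have "(\<forall>k\<in>{1..l}. \<beta> \<bullet> coweight k \<ge> 0) \<or> (\<forall>k\<in>{1..l}. \<beta> \<bullet> coweight k \<le> 0)"
    using assms
  proof (cases rule: root_cases)
    case (short a p)
    then have "\<beta> \<bullet> coweight k = a * (if p \<le> k then 1 else 0)" if "k \<in> {1..l}" for k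
      using that by (simp add: e_coweight)
    with short(1) show ?thesis by auto
  next
    case (long a b p q)
    then have "\<beta> \<bullet> coweight k = a * (if p \<le> k then 1 else 0) + b * (if q \<le> k then 1 else 0)"
      if "k \<in> {1..l}" for k
      using that by (simp add: e_coweight inner_add_left)
    with long(1,2,5) show ?thesis by auto
  qed
  then show ?thesis using assms minus_root_B[OF assms] by (auto simp: positive_iff)
qed

lemma positive_root_cases [consumes 1, case_names short long]:
  assumes "x \<in> positive_roots \<Phi> \<alpha> l"
  obtains p where "p \<in> {1..l}" "x = e p"
  | b p q where "b \<in> {1, -1}" "p \<in> {1..l}" "q \<in> {1..l}" "p < q" "x = e p + b *\<^sub>R e q"
proof -
  have "x \<in> \<Phi>" and pos: "\<And>k. k \<in> {1..l} \<Longrightarrow> x \<bullet> coweight k \<ge> 0"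
    using assms by (auto simp: positive_iff)
  from this(1) show ?thesis
  proof (cases rule: root_cases)
    case (short a p)
    then show ?thesis using pos[of p] that(1)[of p] by (auto simp: e_coweight)
  next
    case (long a b p q)
    then show ?thesis
      using pos[of p] that(2)[of b p q] by (auto simp: e_coweight inner_add_left inner_diff_left)
  qed
qed

text \<open>Reflecting in \<open>\<alpha> i\<close> changes only the coefficient of \<open>\<alpha> i\<close>. If the result is negative, then all other coefficients of
  the positive root \<open>\<beta>\<close> vanish, so \<open>\<beta>\<close> is a positive multiple of \<open>\<alpha> i\<close>; a coordinate of a root that
  is positive equals one, so the multiple is \<open>\<alpha> i\<close> itself.\<close>

lemma simple_reflection_positive_B:
  assumes i: "i \<in> {1..l}" and \<beta>: "\<beta> \<in> positive_roots \<Phi> \<alpha> l" and ne: "\<beta> \<noteq> \<alpha> i"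
  shows "reflection (\<alpha> i) \<beta> \<in> positive_roots \<Phi> \<alpha> l"
proof (rule ccontr)
  assume "reflection (\<alpha> i) \<beta> \<notin> positive_roots \<Phi> \<alpha> l"
  then have neg: "- reflection (\<alpha> i) \<beta> \<in> positive_roots \<Phi> \<alpha> l"
    using reflection_root_B[OF simple_root_B[OF i]] positive_or_negative_B \<beta>
    by (auto simp: positive_iff)
  have zero: "\<beta> \<bullet> coweight k = 0" if k: "k \<in> {1..l}" "k \<noteq> i" for k
  proof -
    have "reflection (\<alpha> i) \<beta> \<bullet> coweight k = \<beta> \<bullet> coweight k"
      using k i by (simp add: reflection_def inner_diff_left simple_coweight)
    moreover have "- reflection (\<alpha> i) \<beta> \<bullet> coweight k \<ge> 0" "\<beta> \<bullet> coweight k \<ge> 0"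
      using neg \<beta> k by (auto simp: positive_iff)
    ultimately show ?thesis by simp
  qed
  define c where "c = \<beta> \<bullet> coweight i"
  have "\<beta> = (\<Sum>k = 1..l. (\<beta> \<bullet> coweight k) *\<^sub>R \<alpha> k)" by (rule simple_expansion)
  also have "\<dots> = (\<Sum>k\<in>{i}. (\<beta> \<bullet> coweight k) *\<^sub>R \<alpha> k)"
    using i zero by (intro sum.mono_neutral_right) auto
  finally have eq: "\<beta> = c *\<^sub>R \<alpha> i" by (simp add: c_def)
  have "\<alpha> i \<bullet> e i = 1" using i by (auto simp: simple_B_def inner_diff_left e_inner)
  then have "\<beta> \<bullet> e i = c" by (simp add: eq)
  then have "c \<in> {-1, 0, 1}" using root_coordinate[of \<beta> i] \<beta> i by (auto simp: positive_iff)
  moreover have "c \<ge> 0" using \<beta> i by (simp add: c_def positive_iff)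
  moreover have "c \<noteq> 0" using \<beta> eq by (auto simp: positive_iff root_iff)
  ultimately have "c = 1" by auto
  then show False using eq ne by simp
qed

text \<open>Such a map permutes the positive roots of length one, which are the basis vectors. As \<open>e p - e q\<close> is
  positive exactly when \<open>p < q\<close>, the permutation is increasing and hence trivial.\<close>

lemma rigid_B:
  assumes w: "w \<in> root_symmetries \<Phi>"
    and pos: "w ` positive_roots \<Phi> \<alpha> l \<subseteq> positive_roots \<Phi> \<alpha> l"
  shows "w = id"
proof -
  have ort: "orthogonal_transformation w" and lin: "linear w"
    using w by (auto simp: root_symmetries_def orthogonal_transformation_def)
  have "\<exists>q\<in>{1..l}. w (e p) = e q" if p: "p \<in> {1..l}" for p
  proof -
    have "w (e p) \<in> positive_roots \<Phi> \<alpha> l" using pos e_positive[OF p] by auto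
    moreover have "w (e p) \<bullet> w (e p) = 1"
      using ort p by (simp add: orthogonal_transformation_def e_inner)
    ultimately show ?thesis
      by (cases rule: positive_root_cases) (auto simp: inner_add_left inner_add_right inner_diff_left inner_diff_right e_inner)
  qed
  then obtain f where f: "\<And>p. p \<in> {1..l} \<Longrightarrow> f p \<in> {1..l} \<and> w (e p) = e (f p)" by metis
  have mono: "f p < f q" if pq: "1 \<le> p" "q \<le> l" "p < q" for p q
  proof (rule ccontr)
    assume less: "\<not> f p < f q"
    have in_range: "p \<in> {1..l}" "q \<in> {1..l}" using pq by auto
    have "e p - e q \<in> positive_roots \<Phi> \<alpha> l"
      using in_range pq(3)
      by (auto simp: positive_iff e_coweight root_iff e_inner inner_diff_left inner_diff_right)
    then have "w (e p - e q) \<in> positive_roots \<Phi> \<alpha> l" using pos by auto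
    then have "e (f p) - e (f q) \<in> positive_roots \<Phi> \<alpha> l"
      using f[OF in_range(1)] f[OF in_range(2)] linear_diff[OF lin, of "e p" "e q"] by simp
    then have "(e (f p) - e (f q)) \<bullet> coweight (f q) \<ge> 0" "e (f p) - e (f q) \<in> \<Phi>"
      using f[OF in_range(2)] by (auto simp: positive_iff)
    then have "f p = f q"
      using f[OF in_range(1)] f[OF in_range(2)] less
      by (auto simp: inner_diff_left e_coweight split: if_splits)
    with \<open>e (f p) - e (f q) \<in> \<Phi>\<close> show False by (simp add: root_iff)
  qed
  have fix_e: "w (e p) = e p" if "p \<in> {1..l}" for p
    using f[OF that] strict_mono_on_interval_id[of l f p] f mono that by auto
  show ?thesis
  proof
    fix x
    have "w x = w (\<Sum>p = 1..l. (x \<bullet> e p) *\<^sub>R e p)" using e_expansion[of x] by simp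
    also have "\<dots> = (\<Sum>p = 1..l. (x \<bullet> e p) *\<^sub>R e p)"
      by (simp add: linear_sum[OF lin] linear_cmul[OF lin] fix_e)
    finally show "w x = id x" using e_expansion[of x] by simp
  qed
qed

text \<open>Summing all coweights gives a height for which every simple root has height one.\<close>

sublocale simple_system \<Phi> \<alpha> l "\<Sum>k = 1..l. coweight k"
proof
  show "\<alpha> i \<bullet> (\<Sum>k = 1..l. coweight k) > 0" if "i \<in> {1..l}" for i
    using that by (simp add: inner_sum_right simple_coweight)
  show "0 \<notin> \<Phi>" by (simp add: root_iff)
  show "w = id" if "w \<in> root_symmetries \<Phi>"
    "w ` positive_roots \<Phi> \<alpha> l \<subseteq> positive_roots \<Phi> \<alpha> l" for w
    using that by (rule rigid_B)
  show "reflection (\<alpha> i) \<beta> \<in> positive_roots \<Phi> \<alpha> l"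
    if "i \<in> {1..l}" "\<beta> \<in> positive_roots \<Phi> \<alpha> l" "\<beta> \<noteq> \<alpha> i" for i \<beta>
    using that by (rule simple_reflection_positive_B)
  show "\<beta> \<in> positive_roots \<Phi> \<alpha> l \<or> - \<beta> \<in> positive_roots \<Phi> \<alpha> l"
    if "\<beta> \<in> \<Phi>" for \<beta>
    using that by (rule positive_or_negative_B)
  show "reflection \<gamma> \<beta> \<in> \<Phi>" if "\<gamma> \<in> \<Phi>" "\<beta> \<in> \<Phi>" for \<gamma> \<beta>
    using that by (rule reflection_root_B)
  show "- \<beta> \<in> \<Phi>" if "\<beta> \<in> \<Phi>" for \<beta> using that by (rule minus_root_B)
  show "\<alpha> i \<in> \<Phi>" if "i \<in> {1..l}" for i using that by (rule simple_root_B)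
  show "finite \<Phi>" by (rule finite_roots_B)
qed

section \<open>The automorphism omega\<close>

text \<open>The sign change of the coordinates in \<open>A\<close>, written so that it is visibly a product of the reflections in
  the \<open>e p\<close>.\<close>

definition flip :: "nat set \<Rightarrow> 'a \<Rightarrow> 'a" where
  "flip A x = x - (\<Sum>p\<in>A. (2 * (x \<bullet> e p)) *\<^sub>R e p)"

lemma reflection_e: "p \<in> {1..l} \<Longrightarrow> reflection (e p) x = x - (2 * (x \<bullet> e p)) *\<^sub>R e p"
  by (simp add: reflection_def e_inner)

lemma flip_all: "flip {1..l} x = - x"
proof -
  have "(\<Sum>p = 1..l. (2 * (x \<bullet> e p)) *\<^sub>R e p) = 2 *\<^sub>R (\<Sum>p = 1..l. (x \<bullet> e p) *\<^sub>R e p)"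
    by (simp add: scaleR_sum_right)
  also have "\<dots> = 2 *\<^sub>R x" using e_expansion[of x] by simp
  finally show ?thesis by (simp add: flip_def scaleR_2)
qed

lemma flip_rest: "flip ({1..l} - {1}) x = - reflection (e 1) x"
proof -
  have "(\<Sum>p = 1..l. (2 * (x \<bullet> e p)) *\<^sub>R e p) =
      (2 * (x \<bullet> e 1)) *\<^sub>R e 1 + (\<Sum>p\<in>{1..l} - {1}. (2 * (x \<bullet> e p)) *\<^sub>R e p)"
    using rank by (intro sum.remove) auto
  then show ?thesis using flip_all[of x] rank by (simp add: flip_def reflection_e algebra_simps)
qed

lemma flip_in_generate:
  assumes inv: "\<And>s. s \<in> S \<Longrightarrow> s \<circ> s = id"
    and "finite A" "A \<subseteq> {1..l}"
    and "\<And>p. p \<in> A \<Longrightarrow> reflection (e p) \<in> generate (BijGroup UNIV) S"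
  shows "flip A \<in> generate (BijGroup UNIV) S"
  using assms(2-4)
proof (induction A)
  case empty
  have "flip {} = id" by (auto simp: flip_def)
  then show ?case by (simp only: generate_BijGroup_id)
next
  case (insert p A)
  then have orth: "e q \<bullet> e p = 0" if "q \<in> A" for q using that by (subst e_inner) auto
  have "flip A x \<bullet> e p = x \<bullet> e p" for x
    by (simp add: flip_def inner_diff_left inner_sum_left orth)
  then have "flip (insert p A) = reflection (e p) \<circ> flip A"
    using insert by (auto simp: fun_eq_iff reflection_e flip_def algebra_simps)
  then show ?case
    using insert generate_BijGroup_comp[OF inv, of S] by (metis insert_iff insert_subset)
qed

text \<open>Descending from \<open>e l = \<alpha> l\<close>: the reflection in \<open>\<alpha> p = e p - e (p + 1)\<close> exchanges these two basis vectors and so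
  conjugates one reflection into the other.\<close>

lemma reflection_e_in_parabolic:
  assumes "m \<in> {1..l}" "p \<in> {m..l}"
  shows "reflection (e p) \<in> parabolic_subgroup \<alpha> {m..l}"
proof -
  have "p \<le> l" "m \<le> p" using assms by auto
  then show ?thesis
  proof (induction p rule: inc_induct)
    case base
    then show ?case
      using assms unfolding parabolic_subgroup_def
      by (intro generate.incl) (auto simp: simple_B_def intro!: image_eqI[of _ _ l])
  next
    case (step p)
    then have p: "p \<in> {1..l}" "Suc p \<in> {1..l}" "p < l" using assms by auto
    have sp: "s p \<in> parabolic_subgroup \<alpha> {m..l}"
      using step p unfolding parabolic_subgroup_def by (intro generate.incl) auto
    have "s p (e (Suc p)) = e p"
      using p by (simp add: reflection_def simple_B_def inner_diff_left inner_diff_right e_inner)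
    then have "reflection (e p) \<circ> s p = s p \<circ> reflection (e (Suc p))"
      using reflection_conjugate[OF orthogonal_transformation_reflection, of "\<alpha> p" "e (Suc p)"] by simp
    then have "reflection (e p) = s p \<circ> (reflection (e (Suc p)) \<circ> s p)"
      by (simp add: fun_eq_iff) (metis reflection_reflection)
    then show ?case
      using sp step generate_BijGroup_comp[of "(\<lambda>i. s i) ` {m..l}"] reflection_involution
      unfolding parabolic_subgroup_def by (metis (no_types, lifting) Suc_leD imageE le_SucI)
  qed
qed

lemma longest_weyl: "longest_element \<alpha> l (weyl_group \<Phi>) = uminus"
proof (rule longest_element_eqI)
  show "weyl_group \<Phi> \<subseteq> G"
    unfolding weyl_group_def
  proof
    fix w assume "w \<in> generate (BijGroup UNIV) (reflection ` \<Phi>)"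
    then show "w \<in> G"
    proof (induction rule: generate_BijGroup_induct)
      case (involution t)
      then show ?case by (auto simp: reflection_involution)
    next
      case id
      show ?case by (rule root_symmetries_id)
    next
      case (gen t)
      then show ?case by (auto intro: reflection_root_symmetries reflection_root_B)
    next
      case (comp v w)
      then show ?case by (rule root_symmetries_comp)
    qed
  qed
  have "flip {1..l} \<in> weyl_group \<Phi>"
    unfolding weyl_group_def
    by (rule flip_in_generate)
       (auto simp: reflection_involution root_iff e_inner intro!: generate.incl imageI)
  then show "uminus \<in> weyl_group \<Phi>" using flip_all by (metis ext)
  show "inversions w \<subseteq> inversions uminus" for w
    by (auto simp: inversions_def)
qed

text \<open>The negative of the reflection in \<open>e 1\<close> is the map that fixes \<open>e 1\<close> and negates its orthogonal complement.
  It inverts every positive root orthogonal to \<open>e 1\<close>, and an element of the subgroup fixes \<open>e 1\<close>, so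
  it cannot invert any other root.\<close>

lemma longest_parabolic:
  "longest_element \<alpha> l (parabolic_subgroup \<alpha> ({1..l} - {1})) = (\<lambda>x. - reflection (e 1) x)"
proof (rule longest_element_eqI)
  have fixes_e1: "w \<in> G \<and> w (e 1) = e 1"
    if "w \<in> parabolic_subgroup \<alpha> ({1..l} - {1})" for w
    using that unfolding parabolic_subgroup_def
  proof (induction rule: generate_BijGroup_induct)
    case (involution t)
    then show ?case by (auto simp: reflection_involution)
  next
    case id
    show ?case by (intro conjI root_symmetries_id) simp
  next
    case (gen t)
    then obtain i where i: "i \<in> {1..l}" "i \<noteq> 1" "t = s i" by blast
    then have "e 1 \<bullet> \<alpha> i = 0" by (auto simp: simple_B_def inner_diff_right e_inner)
    then have "s i (e 1) = e 1" by (simp add: reflection_def)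
    then show ?case using i simple_reflection_symmetry by blast
  next
    case (comp v w)
    then show ?case by (intro conjI root_symmetries_comp) simp_all
  qed
  then show "parabolic_subgroup \<alpha> ({1..l} - {1}) \<subseteq> G" by blast
  have range: "{1..l} - {1} = {2..l}" by auto
  have "flip ({1..l} - {1}) \<in> parabolic_subgroup \<alpha> ({1..l} - {1})"
    unfolding parabolic_subgroup_def
  proof (rule flip_in_generate)
    fix p assume "p \<in> {1..l} - {1}"
    then show "reflection (e p) \<in> generate (BijGroup UNIV) (s ` ({1..l} - {1}))"
      using reflection_e_in_parabolic[of 2 p] rank unfolding range parabolic_subgroup_def by auto
  qed (auto simp: reflection_involution)
  then show "(\<lambda>x. - reflection (e 1) x) \<in> parabolic_subgroup \<alpha> ({1..l} - {1})"
    using flip_rest by (metis ext)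
  fix w assume w: "w \<in> parabolic_subgroup \<alpha> ({1..l} - {1})"
  show "inversions w \<subseteq> inversions (\<lambda>x. - reflection (e 1) x)"
  proof
    fix \<beta> assume "\<beta> \<in> inversions w"
    then obtain \<gamma> where \<gamma>: "\<beta> \<in> P" "\<gamma> \<in> P" "\<beta> = - w \<gamma>" by (auto simp: inversions_def)
    have "\<And>x. w x \<bullet> e 1 = x \<bullet> e 1"
      using fixes_e1[OF w] by (metis (mono_tags, lifting) mem_Collect_eq orthogonal_transformation_def root_symmetries_def)
    then have "\<beta> \<bullet> e 1 = - (\<gamma> \<bullet> e 1)" using \<gamma>(3) by simp
    moreover have "\<beta> \<bullet> coweight 1 \<ge> 0" "\<gamma> \<bullet> coweight 1 \<ge> 0" using \<gamma> rank by (auto simp: positive_iff)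
    ultimately have "\<beta> \<bullet> e 1 = 0" by (simp add: coweight_def)
    then have "\<beta> = - (- reflection (e 1) \<beta>)" by (simp add: reflection_def)
    then show "\<beta> \<in> inversions (\<lambda>x. - reflection (e 1) x)"
      using \<gamma>(1) unfolding inversions_def by blast
  qed
qed

theorem omega_eq: "omega \<Phi> \<alpha> l 1 = reflection (e 1)"
  unfolding omega_def longest_weyl longest_parabolic by (simp add: fun_eq_iff reflection_minus)

section \<open>Averages and the orbit coweight\<close>

lemma average_reflection_e1: "average (reflection (e 1)) x = x - (x \<bullet> e 1) *\<^sub>R e 1"
proof -
  have one: "1 \<in> {1..l}" using rank by simp
  have "reflection (e 1) (e 1) = - e 1" by (rule reflection_self)
  moreover have "- e 1 \<noteq> e 1"
  proof
    assume eq: "- e 1 = e 1"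
    have "(- e 1) \<bullet> e 1 = e 1 \<bullet> e 1" by (simp only: eq)
    then show False using e_inner[OF one one] by simp
  qed
  ultimately have "reflection (e 1) \<noteq> id" by (metis id_apply)
  then have "group.ord (BijGroup UNIV) (reflection (e 1)) = 2"
    by (intro ord_BijGroup_involution reflection_involution)
  moreover have "{1..2::nat} = {1, 2}" by auto
  ultimately have "average (reflection (e 1)) x = (1/2) *\<^sub>R (reflection (e 1) x + x)"
    by (simp add: average_def numeral_2_eq_2)
  also have "\<dots> = x - (x \<bullet> e 1) *\<^sub>R e 1"
    using one by (simp add: reflection_e algebra_simps flip: scaleR_2)
  finally show ?thesis .
qed

lemma average_zero_iff:
  assumes "\<gamma> \<in> \<Phi>"
  shows "average (reflection (e 1)) \<gamma> = 0 \<longleftrightarrow> \<gamma> = e 1 \<or> \<gamma> = - e 1"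
proof
  have one: "1 \<in> {1..l}" using rank by simp
  assume "average (reflection (e 1)) \<gamma> = 0"
  then have eq: "\<gamma> = (\<gamma> \<bullet> e 1) *\<^sub>R e 1" using average_reflection_e1[of \<gamma>] by simp
  have "\<gamma> \<noteq> 0" using assms by (auto simp: root_iff)
  then show "\<gamma> = e 1 \<or> \<gamma> = - e 1" using root_coordinate[OF assms one] eq by auto
next
  have one: "e 1 \<bullet> e 1 = 1" using rank by (simp add: e_inner)
  assume "\<gamma> = e 1 \<or> \<gamma> = - e 1"
  then show "average (reflection (e 1)) \<gamma> = 0"
    unfolding average_reflection_e1 by (elim disjE) (use one in simp_all)
qed

text \<open>For any root the first coordinate is at most one and all partial sums of coordinates are at most two, and
  \<open>e 1 + e 2\<close> attains all these bounds. Two highest roots have equal partial sums and are equal.\<close>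

lemma highest_root_B: "highest_root \<Phi> \<alpha> l = e 1 + e 2"
  unfolding highest_root_def nat_combination_iff
proof (rule the_equality)
  have in_range: "1 \<in> {1..l}" "2 \<in> {1..l}" using rank by auto
  have root: "e 1 + e 2 \<in> \<Phi>"
    using in_range by (auto simp: root_iff e_inner inner_add_left inner_add_right)
  have "(e 1 + e 2 - \<gamma>) \<bullet> coweight k \<in> \<nat>" if \<gamma>: "\<gamma> \<in> \<Phi>" and k: "k \<in> {1..l}" for \<gamma> k
  proof -
    have "\<gamma> \<bullet> coweight k \<le> (e 1 + e 2) \<bullet> coweight k"
      using \<gamma> by (cases rule: root_cases) (use in_range k in \<open>auto simp: inner_add_left inner_diff_left e_coweight\<close>)
    moreover have "(e 1 + e 2 - \<gamma>) \<bullet> coweight k \<in> \<int>"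
      using coweight_integral[OF _ root] coweight_integral[OF _ \<gamma>] k by (simp add: inner_diff_left)
    ultimately show ?thesis by (simp add: Nats_altdef2 inner_diff_left)
  qed
  with root show highest: "e 1 + e 2 \<in> \<Phi> \<and>
      (\<forall>\<gamma>\<in>\<Phi>. \<forall>k\<in>{1..l}. (e 1 + e 2 - \<gamma>) \<bullet> coweight k \<in> \<nat>)" by blast
  fix \<beta> assume \<beta>: "\<beta> \<in> \<Phi> \<and> (\<forall>\<gamma>\<in>\<Phi>. \<forall>k\<in>{1..l}. (\<beta> - \<gamma>) \<bullet> coweight k \<in> \<nat>)"
  have "\<beta> \<bullet> coweight k = (e 1 + e 2) \<bullet> coweight k" if "k \<in> {1..l}" for k
  proof (rule antisym)
    have "(\<beta> - (e 1 + e 2)) \<bullet> coweight k \<in> \<nat>" "(e 1 + e 2 - \<beta>) \<bullet> coweight k \<in> \<nat>"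
      using \<beta> highest that by blast+
    then show "\<beta> \<bullet> coweight k \<le> (e 1 + e 2) \<bullet> coweight k" "(e 1 + e 2) \<bullet> coweight k \<le> \<beta> \<bullet> coweight k"
      by (auto simp: Nats_altdef2 inner_diff_left)
  qed
  then have "(\<Sum>k = 1..l. (\<beta> \<bullet> coweight k) *\<^sub>R \<alpha> k) =
      (\<Sum>k = 1..l. ((e 1 + e 2) \<bullet> coweight k) *\<^sub>R \<alpha> k)" by (intro sum.cong) auto
  then show "\<beta> = e 1 + e 2"
    using simple_expansion[of \<beta>] simple_expansion[of "e 1 + e 2"] by simp
qed

text \<open>The pairing with the first coweight tells \<open>\<alpha>\<^sub>0\<close> and \<open>\<alpha>\<^sub>1\<close> apart from the other extended simple roots, which
  makes the index permutation well defined on them.\<close>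

lemma ext_simple_coweight:
  assumes "j \<le> l"
  shows "ext_simple \<Phi> \<alpha> l j \<bullet> coweight 1 = (if j = 0 then -1 else if j = 1 then 1 else 0)"
  using assms rank
  by (auto simp: ext_simple_def highest_root_B simple_coweight e_coweight inner_add_left inner_diff_left)

lemma index_perm_swap:
  "index_perm \<Phi> \<alpha> l (reflection (e 1)) 0 = 1"
  "index_perm \<Phi> \<alpha> l (reflection (e 1)) 1 = 0"
proof -
  have \<alpha>0: "ext_simple \<Phi> \<alpha> l 0 = - (e 1 + e 2)" and \<alpha>1: "ext_simple \<Phi> \<alpha> l 1 = e 1 - e 2"
    using rank by (auto simp: ext_simple_def highest_root_B simple_B_def numeral_2_eq_2)
  have "e 2 \<bullet> e 1 = 0" "e 1 \<bullet> e 1 = 1" using rank by (auto simp: e_inner)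
  then have swap: "reflection (e 1) (ext_simple \<Phi> \<alpha> l 0) = ext_simple \<Phi> \<alpha> l 1"
    unfolding \<alpha>0 \<alpha>1 by (simp add: reflection_def inner_add_left inner_diff_left algebra_simps scaleR_2)
  then have swap': "reflection (e 1) (ext_simple \<Phi> \<alpha> l 1) = ext_simple \<Phi> \<alpha> l 0"
    by (metis reflection_reflection)
  have unique: "j = i" if "j \<le> l" "i \<in> {0, 1}" "ext_simple \<Phi> \<alpha> l i = ext_simple \<Phi> \<alpha> l j" for i j
    using that rank ext_simple_coweight[of i] ext_simple_coweight[of j]
    by (auto split: if_splits)
  show "index_perm \<Phi> \<alpha> l (reflection (e 1)) 0 = 1"
    unfolding index_perm_def swap
    using rank unique[of _ 1] by (simp, intro the_equality) auto
  show "index_perm \<Phi> \<alpha> l (reflection (e 1)) 1 = 0"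
    unfolding index_perm_def swap'
    using rank unique[of _ 0] by (simp, intro the_equality) auto
qed

lemma fund_coweight_B: "fund_coweight \<alpha> l 1 = e 1"
proof -
  have dual: "\<alpha> j \<bullet> e 1 = (if j = 1 then 1 else 0)" if "j \<in> {1..l}" for j
    using simple_coweight[OF that, of 1] rank by (simp add: coweight_def)
  have "v = e 1" if v: "\<forall>j\<in>{1..l}. \<alpha> j \<bullet> v = (if j = 1 then 1 else 0)" for v
  proof -
    have "x \<bullet> v = x \<bullet> e 1" for x
    proof -
      have "(\<Sum>k = 1..l. (x \<bullet> coweight k) *\<^sub>R \<alpha> k) \<bullet> v = (\<Sum>k = 1..l. (x \<bullet> coweight k) *\<^sub>R \<alpha> k) \<bullet> e 1"
        unfolding inner_sum_left using v dual by (intro sum.cong) auto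
      then show ?thesis using simple_expansion[of x] by simp
    qed
    then show ?thesis by (metis vector_eq_ldot)
  qed
  then show ?thesis unfolding fund_coweight_def using dual by (auto intro!: the_equality)
qed

lemma orbit_coweight_B: "orbit_coweight \<Phi> \<alpha> l (reflection (e 1)) 0 = e 1"
proof -
  let ?\<sigma> = "index_perm \<Phi> \<alpha> l (reflection (e 1))"
  have "x \<in> {0, 1}" if "x \<in> orbit ?\<sigma> 0" for x
    using that by induction (use index_perm_swap in auto)
  moreover have "1 \<in> orbit ?\<sigma> 0" using orbit.base[of ?\<sigma> 0] index_perm_swap by simp
  moreover from this have "0 \<in> orbit ?\<sigma> 0" using orbit.step[of 1 ?\<sigma> 0] index_perm_swap by simp
  ultimately have "orbit ?\<sigma> 0 = {0, 1}" by blast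
  then show ?thesis using fund_coweight_B by (simp add: orbit_coweight_def fund_coweight_def)
qed

lemma e1_eq_sum_simple: "e 1 = (\<Sum>i = 1..l. \<alpha> i)"
proof -
  have "e 1 = (\<Sum>k = 1..l. (e 1 \<bullet> coweight k) *\<^sub>R \<alpha> k)" by (rule simple_expansion)
  also have "\<dots> = (\<Sum>i = 1..l. \<alpha> i)" using rank by (intro sum.cong) (auto simp: e_coweight)
  finally show ?thesis .
qed

end

theorem proposition5p5:
  fixes e :: "nat \<Rightarrow> real ^ 'n" and l :: nat
  assumes rank: "l = CARD('n)" "l \<ge> 2"
    and std_basis: "bij_betw e {1..l} Basis"
  defines "\<Phi> \<equiv> roots_B e l"
    and "\<alpha> \<equiv> simple_B e l"
  defines "\<omega> \<equiv> omega \<Phi> \<alpha> l 1"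
  shows "vanishing_positive_roots \<Phi> \<alpha> l \<omega> = {e 1} \<and>
         {e 1} = {\<Sum>i = 1..l. \<alpha> i} \<and>
         P_zero \<Phi> \<alpha> l \<omega> = {1, -1}"
proof -
  interpret type_B e l using rank(2) std_basis by unfold_locales
  have \<omega>: "\<omega> = reflection (e 1)" unfolding \<omega>_def \<Phi>_def \<alpha>_def by (rule omega_eq)
  have one: "1 \<in> {1..l}" using rank by simp
  have pos: "e 1 \<in> positive_roots \<Phi> \<alpha> l" and neg: "- e 1 \<notin> positive_roots \<Phi> \<alpha> l"
    using e_positive[OF one] minus_not_positive unfolding \<Phi>_def \<alpha>_def by blast+
  have roots: "e 1 \<in> \<Phi>" "- e 1 \<in> \<Phi>"
    using e_positive[OF one] positive_imp_root minus_root unfolding \<Phi>_def by blast+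
  have kernel: "average \<omega> \<gamma> = 0 \<longleftrightarrow> \<gamma> = e 1 \<or> \<gamma> = - e 1" if "\<gamma> \<in> \<Phi>" for \<gamma>
    using average_zero_iff that unfolding \<omega> \<Phi>_def by blast
  have "vanishing_positive_roots \<Phi> \<alpha> l \<omega> = {e 1}"
  proof -
    have "\<beta> \<in> \<Phi>" if "\<beta> \<in> positive_roots \<Phi> \<alpha> l" for \<beta> using that by (simp add: positive_roots_def)
    then show ?thesis unfolding vanishing_positive_roots_def using kernel pos neg by blast
  qed
  moreover have "P_zero \<Phi> \<alpha> l \<omega> = {1, -1}"
  proof -
    have "orbit_coweight \<Phi> \<alpha> l \<omega> 0 = e 1"
      unfolding \<omega> \<Phi>_def \<alpha>_def by (rule orbit_coweight_B)
    then have "P_zero \<Phi> \<alpha> l \<omega> = (\<lambda>\<gamma>. \<gamma> \<bullet> e 1) ` {\<gamma> \<in> \<Phi>. average \<omega> \<gamma> = 0}"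
      unfolding P_zero_def by auto
    also have "{\<gamma> \<in> \<Phi>. average \<omega> \<gamma> = 0} = {e 1, - e 1}" using kernel roots by blast
    finally show ?thesis using e_inner[OF one one] by simp
  qed
  ultimately show ?thesis using e1_eq_sum_simple unfolding \<alpha>_def by simp
qed

end
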